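(* There exists a totally disconnected Polish group which is quasi non-archimedean, but not non-archimedean.
   Context: A Polish group is a separable topological group whose topology admits a compatible complete metric. A topological group is totally disconnected if its connected components are singletons. A topological group is non-archimedean if it has a basis of neighborhoods of the identity made of open subgroups. A topological group $G$ is quasi non-archimedean if for every $n\in\mathbb{N}$ and every neighborhood of the identity $V\subseteq G$, there exists a neighborhood of the identity $U\subseteq V$ such that for all $g_1,\dots,g_n\in U$, the group generated by $g_1,\dots,g_n$ is contained in $V$. *)

theory Defs
  imports "HOL-Analysis.Analysis" "HOL-Algebra.Generated_Groups"
begin

text \<open>Groups are records of HOL-Algebra; the topology is a separate argument whose underlying
  space is the carrier. A Polish space has at most continuum many points, so every Polish group is
  isomorphic to one whose carrier is a set of reals; existence of a Polish group can therefore be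
  stated over the carrier type \<^typ>\<open>real\<close>, with a topology unrelated to that of the reals.\<close>

locale topological_group = group G
  for G :: "('a, 'b) monoid_scheme" (structure) and T :: "'a topology" +
  assumes topspace_eq_carrier: "topspace T = carrier G"
    and continuous_mult: "continuous_map (prod_topology T T) T (\<lambda>(x, y). x \<otimes> y)"
    and continuous_inv: "continuous_map T T (\<lambda>x. inv x)"

locale polish_group = topological_group +
  assumes separable: "separable_space T"
    and completely_metrizable: "completely_metrizable_space T"

definition totally_disconnected :: "'a topology \<Rightarrow> bool" where
  "totally_disconnected T \<longleftrightarrow> (\<forall>C \<in> connected_components_of T. \<exists>x. C = {x})"

text \<open>Neighborhoods need not be open.\<close>

definition neighborhood :: "'a topology \<Rightarrow> 'a \<Rightarrow> 'a set \<Rightarrow> bool" where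
  "neighborhood T x V \<longleftrightarrow> V \<subseteq> topspace T \<and> (\<exists>W. openin T W \<and> x \<in> W \<and> W \<subseteq> V)"

definition non_archimedean :: "('a, 'b) monoid_scheme \<Rightarrow> 'a topology \<Rightarrow> bool" where
  "non_archimedean G T \<longleftrightarrow>
     neighbourhood_base_at \<one>\<^bsub>G\<^esub> (\<lambda>H. subgroup H G \<and> openin T H) T"

definition quasi_non_archimedean :: "('a, 'b) monoid_scheme \<Rightarrow> 'a topology \<Rightarrow> bool" where
  "quasi_non_archimedean G T \<longleftrightarrow>
     (\<forall>(n::nat) V. neighborhood T \<one>\<^bsub>G\<^esub> V \<longrightarrow>
        (\<exists>U. neighborhood T \<one>\<^bsub>G\<^esub> U \<and> U \<subseteq> V \<and>
           (\<forall>g :: nat \<Rightarrow> 'a. (\<forall>i<n. g i \<in> U) \<longrightarrow> generate G (g ` {..<n}) \<subseteq> V)))"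

end

theory Submission
  imports Defs
begin

text \<open>
  Let \<open>w\<close> be positive weights on the natural numbers that tend to \<open>0\<close> and have infinite sum. The sets
  of finite weight form a Boolean group under symmetric difference, and the weight of the symmetric
  difference of two sets is an invariant metric on it. This group, a summable ideal, is the example.

  It is Polish: a Cauchy sequence stabilises at every coordinate, hence has a coordinatewise limit,
  and the weight, being a supremum over finite subsets, is lower semicontinuous for coordinatewise
  convergence, so this limit is also the metric one (\<open>mcomplete\<close>). Finite sets are dense. It is
  totally disconnected because membership of a given \<open>k\<close> is a clopen condition: it cannot change
  within distance \<open>w k\<close> (\<open>mem_supp_eq_of_close\<close>).

  It is quasi non-archimedean for the reason that makes the measure algebra of a probability space
  so: every element of the group generated by \<open>n\<close> sets is contained in their union, whose weight is
  at most the sum of the \<open>n\<close> weights (\<open>quasi_non_archimedean\<close>). The bound depends on \<open>n\<close>, and no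
  bound uniform in \<open>n\<close> can exist: since \<open>w\<close> tends to \<open>0\<close>, an open subgroup contains all singletons
  far out, hence all finite sets far out, and these have unbounded weight as \<open>w\<close> is not summable
  (\<open>not_non_archimedean\<close>).

  There are as many sets of natural numbers as reals, so the example can be carried by a set of
  reals; the harmonic weights \<open>1 / (n + 1)\<close> are one possible choice.
\<close>

section \<open>Weights of sets of natural numbers\<close>

locale positive_weight =
  fixes w :: "nat \<Rightarrow> real"
  assumes w_pos: "0 < w n"
begin

text \<open>A set of infinite weight gets the default value \<open>0\<close>, which is why comparisons of weights
  carry summability hypotheses.\<close>

definition weight :: "nat set \<Rightarrow> real" where
  "weight A = infsum w A"

lemma w_nonneg: "0 \<le> w n"
  using w_pos less_imp_le by blast

lemma weight_nonneg: "0 \<le> weight A"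
  unfolding weight_def by (rule infsum_nonneg) (rule w_nonneg)

lemma weight_mono:
  assumes "w summable_on B" "A \<subseteq> B"
  shows "weight A \<le> weight B"
  unfolding weight_def
  by (rule infsum_mono2) (use assms summable_on_subset_banach w_nonneg in auto)

lemma w_le_weight: "w summable_on A \<Longrightarrow> k \<in> A \<Longrightarrow> w k \<le> weight A"
  using weight_mono[of A "{k}"] by (simp add: weight_def)

lemma weight_eq_0_iff: "w summable_on A \<Longrightarrow> weight A = 0 \<longleftrightarrow> A = {}"
  using w_le_weight[of A] w_pos by (auto simp: weight_def) (metis not_less)

lemma summable_on_Un:
  assumes "w summable_on A" "w summable_on B"
  shows "w summable_on (A \<union> B)"
proof -
  have "w summable_on (A \<union> (B - A))"
    using assms summable_on_subset_banach[of w B "B - A"] by (intro summable_on_Un_disjoint) auto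
  then show ?thesis by simp
qed

lemma weight_Un_le:
  assumes "w summable_on A" "w summable_on B"
  shows "weight (A \<union> B) \<le> weight A + weight B"
proof -
  have "weight (A \<union> (B - A)) = weight A + weight (B - A)"
    unfolding weight_def
    using assms summable_on_subset_banach[of w B "B - A"] by (intro infsum_Un_disjoint) auto
  then show ?thesis
    using weight_mono[of B "B - A"] assms by simp
qed

lemma summable_on_sym_diff:
  "w summable_on A \<Longrightarrow> w summable_on B \<Longrightarrow> w summable_on sym_diff A B"
  using summable_on_Un summable_on_subset_banach by (metis Diff_subset)

lemma weight_UN_le:
  fixes n :: nat
  assumes "\<And>i. i < n \<Longrightarrow> w summable_on A i"
  shows "w summable_on (\<Union>i<n. A i) \<and> weight (\<Union>i<n. A i) \<le> (\<Sum>i<n. weight (A i))"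
  using assms
proof (induction n)
  case 0
  then show ?case by (simp add: weight_def)
next
  case (Suc n)
  have "(\<Union>i<Suc n. A i) = (\<Union>i<n. A i) \<union> A n"
    by (auto simp: less_Suc_eq)
  then show ?case
    using Suc weight_Un_le[of "\<Union>i<n. A i" "A n"] summable_on_Un[of "\<Union>i<n. A i" "A n"] by auto
qed

text \<open>Both the finiteness of a weight and a bound on it can be tested on finite subsets; this is the
  lower semicontinuity on which completeness rests.\<close>

lemma weight_le_of_finite_subsets:
  assumes "\<And>F. finite F \<Longrightarrow> F \<subseteq> A \<Longrightarrow> sum w F \<le> c"
  shows "w summable_on A \<and> weight A \<le> c"
proof -
  have "w summable_on A"
    using assms w_nonneg by (intro nonneg_bdd_above_summable_on bdd_aboveI2[where M = c]) auto
  then show ?thesis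
    unfolding weight_def using assms infsum_le_finite_sums by blast
qed

lemma finite_approximation:
  assumes "w summable_on A" "0 < r"
  obtains F where "finite F" "F \<subseteq> A" "weight (A - F) < r"
proof -
  obtain F where F: "finite F" "F \<subseteq> A" "\<bar>sum w F - infsum w A\<bar> \<le> r / 2"
    using infsum_finite_approximation[OF assms(1), of "r / 2"] assms(2) by (auto simp: dist_real_def)
  have "weight (A - F) + weight F = weight A"
    unfolding weight_def using F assms(1) summable_on_subset_banach[OF assms(1), of "A - F"]
    by (subst infsum_Un_disjoint[symmetric]) (auto simp: Un_absorb2)
  with F have "weight (A - F) < r"
    using assms(2) unfolding weight_def infsum_finite[OF F(1)] by linarith
  with F that show thesis by blast
qed

end

section \<open>The Polish group of sets of finite weight\<close>

text \<open>The group lives on any type that codes the sets of natural numbers by a bijection \<open>supp\<close>;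
  multiplication is symmetric difference of the coded sets.\<close>

locale summable_ideal = positive_weight w
  for w :: "nat \<Rightarrow> real" +
  fixes supp :: "'a \<Rightarrow> nat set"
  assumes bij_supp: "bij supp"
begin

definition code :: "nat set \<Rightarrow> 'a" where
  "code = inv_into UNIV supp"

definition I :: "'a monoid" where
  "I = \<lparr>carrier = {x. w summable_on supp x},
        monoid.mult = (\<lambda>x y. code (sym_diff (supp x) (supp y))),
        one = code {}\<rparr>"

definition d :: "'a \<Rightarrow> 'a \<Rightarrow> real" where
  "d x y = weight (sym_diff (supp x) (supp y))"

lemma supp_code [simp]: "supp (code A) = A"
  unfolding code_def using bij_supp by (simp add: bij_is_surj surj_f_inv_f)

lemma supp_eq_iff: "supp x = supp y \<longleftrightarrow> x = y"
  using bij_supp by (metis bij_is_inj injD)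

lemma mem_carrier: "x \<in> carrier I \<longleftrightarrow> w summable_on supp x"
  by (simp add: I_def)

lemma supp_mult [simp]: "supp (x \<otimes>\<^bsub>I\<^esub> y) = sym_diff (supp x) (supp y)"
  by (simp add: I_def)

lemma supp_one [simp]: "supp \<one>\<^bsub>I\<^esub> = {}"
  by (simp add: I_def)

lemma mult_self: "x \<otimes>\<^bsub>I\<^esub> x = \<one>\<^bsub>I\<^esub>"
  by (simp flip: supp_eq_iff)

sublocale group I
proof (rule groupI)
  show "x \<otimes>\<^bsub>I\<^esub> y \<in> carrier I" if "x \<in> carrier I" "y \<in> carrier I" for x y
    using that summable_on_sym_diff by (simp add: mem_carrier)
  show "\<exists>y\<in>carrier I. y \<otimes>\<^bsub>I\<^esub> x = \<one>\<^bsub>I\<^esub>" if "x \<in> carrier I" for x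
    using that mult_self by blast
qed (auto simp: mem_carrier simp flip: supp_eq_iff)

lemma inv_eq_self: "x \<in> carrier I \<Longrightarrow> inv\<^bsub>I\<^esub> x = x"
  using mult_self inv_equality by blast

sublocale Metric_space "carrier I" d
proof
  fix x y z assume xyz: "x \<in> carrier I" "y \<in> carrier I" "z \<in> carrier I"
  show "d x z \<le> d x y + d y z"
  proof -
    have "d x z \<le> weight (sym_diff (supp x) (supp y) \<union> sym_diff (supp y) (supp z))"
      unfolding d_def using xyz summable_on_Un summable_on_sym_diff
      by (intro weight_mono) (auto simp: mem_carrier)
    also have "\<dots> \<le> d x y + d y z"
      unfolding d_def using xyz summable_on_sym_diff
      by (intro weight_Un_le) (auto simp: mem_carrier)
    finally show ?thesis .
  qed
next
  fix x y assume "x \<in> carrier I" "y \<in> carrier I"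
  then show "d x y = 0 \<longleftrightarrow> x = y"
    unfolding d_def using summable_on_sym_diff
    by (subst weight_eq_0_iff) (auto simp: mem_carrier simp flip: supp_eq_iff)
qed (auto simp: d_def weight_nonneg Un_commute)

abbreviation T :: "'a topology" where
  "T \<equiv> mtopology"

lemma d_one: "d \<one>\<^bsub>I\<^esub> x = weight (supp x)"
  by (simp add: d_def)

text \<open>This gives continuity of multiplication: a coordinate where the products differ is one where
  some pair of factors differs.\<close>

lemma d_mult_le:
  assumes "x \<in> carrier I" "y \<in> carrier I" "x' \<in> carrier I" "y' \<in> carrier I"
  shows "d (x \<otimes>\<^bsub>I\<^esub> y) (x' \<otimes>\<^bsub>I\<^esub> y') \<le> d x x' + d y y'"
proof -
  have "d (x \<otimes>\<^bsub>I\<^esub> y) (x' \<otimes>\<^bsub>I\<^esub> y')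
      \<le> weight (sym_diff (supp x) (supp x') \<union> sym_diff (supp y) (supp y'))"
    unfolding d_def supp_mult using assms summable_on_Un summable_on_sym_diff
    by (intro weight_mono) (auto simp: mem_carrier)
  also have "\<dots> \<le> d x x' + d y y'"
    unfolding d_def using assms summable_on_sym_diff
    by (intro weight_Un_le) (auto simp: mem_carrier)
  finally show ?thesis .
qed

text \<open>A single coordinate \<open>k\<close> of disagreement already costs distance \<open>w k\<close>. Hence convergence in
  the metric implies coordinatewise convergence, and coordinates give clopen partitions.\<close>

lemma mem_supp_eq_of_close:
  assumes "x \<in> carrier I" "y \<in> carrier I" "d x y < w k"
  shows "k \<in> supp x \<longleftrightarrow> k \<in> supp y"
proof (rule ccontr)
  assume "\<not> ?thesis"
  then have "k \<in> sym_diff (supp x) (supp y)" by blast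
  then have "w k \<le> d x y"
    unfolding d_def using assms summable_on_sym_diff by (intro w_le_weight) (auto simp: mem_carrier)
  with assms(3) show False by simp
qed

lemma topological_group: "topological_group I T"
proof (intro topological_group.intro topological_group_axioms.intro is_group)
  show "continuous_map (prod_topology T T) T (\<lambda>(x, y). x \<otimes>\<^bsub>I\<^esub> y)"
    unfolding continuous_map_def
  proof (intro conjI allI impI)
    fix U assume U: "openin T U"
    show "openin (prod_topology T T)
      {p \<in> topspace (prod_topology T T). (case p of (x, y) \<Rightarrow> x \<otimes>\<^bsub>I\<^esub> y) \<in> U}"
      unfolding openin_prod_topology_alt
    proof (intro allI impI)
      fix x y
      assume "(x, y) \<in> {p \<in> topspace (prod_topology T T). (case p of (x, y) \<Rightarrow> x \<otimes>\<^bsub>I\<^esub> y) \<in> U}"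
      then have xy: "x \<in> carrier I" "y \<in> carrier I" and "x \<otimes>\<^bsub>I\<^esub> y \<in> U" by auto
      then obtain r where r: "r > 0" "mball (x \<otimes>\<^bsub>I\<^esub> y) r \<subseteq> U"
        using U by (auto simp: openin_mtopology)
      have "x' \<otimes>\<^bsub>I\<^esub> y' \<in> U" if "x' \<in> mball x (r / 2)" "y' \<in> mball y (r / 2)" for x' y'
      proof -
        have "x' \<otimes>\<^bsub>I\<^esub> y' \<in> mball (x \<otimes>\<^bsub>I\<^esub> y) r"
          using that d_mult_le[OF xy, of x' y'] xy by auto
        with r show ?thesis by blast
      qed
      then show "\<exists>U' V'. openin T U' \<and> openin T V' \<and> x \<in> U' \<and> y \<in> V' \<and>
          U' \<times> V' \<subseteq> {p \<in> topspace (prod_topology T T). (case p of (x, y) \<Rightarrow> x \<otimes>\<^bsub>I\<^esub> y) \<in> U}"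
        using xy r by (intro exI[of _ "mball x (r / 2)"] exI[of _ "mball y (r / 2)"]) auto
    qed
  qed auto
  show "continuous_map T T (\<lambda>x. inv\<^bsub>I\<^esub> x)"
    by (rule continuous_map_eq[OF continuous_map_id]) (simp add: inv_eq_self)
qed simp

lemma separable: "separable_space T"
proof -
  let ?D = "code ` Collect finite"
  have "\<exists>y\<in>?D. y \<in> mball x r" if "x \<in> carrier I" "0 < r" for x r
  proof -
    obtain F where F: "finite F" "F \<subseteq> supp x" "weight (supp x - F) < r"
      using finite_approximation[of "supp x" r] \<open>x \<in> carrier I\<close> \<open>0 < r\<close>
      unfolding mem_carrier by blast
    have "sym_diff (supp x) F = supp x - F"
      using F(2) by blast
    then have "d x (code F) < r"
      unfolding d_def supp_code using F(3) by (rule ssubst)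
    moreover have "code F \<in> carrier I"
      using F(1) by (simp add: mem_carrier)
    ultimately show ?thesis
      using \<open>x \<in> carrier I\<close> F(1) unfolding in_mball by blast
  qed
  then have "T closure_of ?D = topspace T"
    unfolding metric_closure_of topspace_mtopology by blast
  moreover have "?D \<subseteq> topspace T"
    by (auto simp: mem_carrier)
  moreover have "countable ?D"
    by (simp add: countable_Collect_finite)
  ultimately show ?thesis
    unfolding separable_space_def by blast
qed

text \<open>Coordinatewise convergence together with the Cauchy property suffices: for large indices every
  finite part of the difference to the limit is also part of the difference to some later term, and
  these differences are uniformly small.\<close>

lemma mcomplete: "mcomplete"
  unfolding mcomplete_def
proof (intro allI impI)
  fix \<sigma> assume \<sigma>: "MCauchy \<sigma>"
  then have carr: "\<sigma> n \<in> carrier I" for n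
    by (auto simp: MCauchy_def)
  define A where "A = {k. \<forall>\<^sub>F n in sequentially. k \<in> supp (\<sigma> n)}"
  have coord: "\<forall>\<^sub>F n in sequentially. k \<in> supp (\<sigma> n) \<longleftrightarrow> k \<in> A" for k
  proof -
    obtain N where N: "\<And>m n. N \<le> m \<Longrightarrow> N \<le> n \<Longrightarrow> d (\<sigma> m) (\<sigma> n) < w k"
      using \<sigma> w_pos[of k] unfolding MCauchy_def by blast
    then have *: "k \<in> supp (\<sigma> n) \<longleftrightarrow> k \<in> supp (\<sigma> N)" if "N \<le> n" for n
      using mem_supp_eq_of_close carr that by blast
    have "k \<in> A \<longleftrightarrow> k \<in> supp (\<sigma> N)"
    proof
      assume "k \<in> A"
      then obtain M where "\<And>n. M \<le> n \<Longrightarrow> k \<in> supp (\<sigma> n)"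
        by (auto simp: A_def eventually_sequentially)
      then show "k \<in> supp (\<sigma> N)" using *[of "max M N"] by (meson max.cobounded1 max.cobounded2)
    next
      assume "k \<in> supp (\<sigma> N)"
      then show "k \<in> A" using * unfolding A_def eventually_sequentially by blast
    qed
    with * show ?thesis unfolding eventually_sequentially by blast
  qed
  have close: "\<exists>N. \<forall>n\<ge>N. w summable_on sym_diff (supp (\<sigma> n)) A \<and>
      weight (sym_diff (supp (\<sigma> n)) A) \<le> r" if "0 < r" for r
  proof -
    obtain N where N: "\<And>m n. N \<le> m \<Longrightarrow> N \<le> n \<Longrightarrow> d (\<sigma> m) (\<sigma> n) < r"
      using \<sigma> \<open>0 < r\<close> unfolding MCauchy_def by blast
    have "sum w F \<le> r"
      if "N \<le> n" and F: "finite F" "F \<subseteq> sym_diff (supp (\<sigma> n)) A" for n F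
    proof -
      have "\<forall>\<^sub>F m in sequentially. N \<le> m \<and> (\<forall>k\<in>F. k \<in> supp (\<sigma> m) \<longleftrightarrow> k \<in> A)"
        using coord F by (intro eventually_conj eventually_ge_at_top) (simp add: eventually_ball_finite)
      then obtain m where m: "N \<le> m" "\<And>k. k \<in> F \<Longrightarrow> k \<in> supp (\<sigma> m) \<longleftrightarrow> k \<in> A"
        using eventually_happens' sequentially_bot by blast
      have "sum w F = weight F"
        using F by (simp add: weight_def)
      also have "\<dots> \<le> d (\<sigma> n) (\<sigma> m)"
        unfolding d_def
      proof (rule weight_mono)
        show "w summable_on sym_diff (supp (\<sigma> n)) (supp (\<sigma> m))"
          using carr summable_on_sym_diff by (simp add: mem_carrier)
        show "F \<subseteq> sym_diff (supp (\<sigma> n)) (supp (\<sigma> m))"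
          using F(2) m(2) by blast
      qed
      finally show ?thesis
        using N[OF \<open>N \<le> n\<close> m(1)] by simp
    qed
    then have "w summable_on sym_diff (supp (\<sigma> n)) A \<and> weight (sym_diff (supp (\<sigma> n)) A) \<le> r"
      if "N \<le> n" for n
      using that by (intro weight_le_of_finite_subsets)
    then show ?thesis by blast
  qed
  have "code A \<in> carrier I"
  proof -
    obtain n where "w summable_on sym_diff (supp (\<sigma> n)) A"
      using close[of 1] by auto
    then have "w summable_on (supp (\<sigma> n) \<union> sym_diff (supp (\<sigma> n)) A)"
      using carr summable_on_Un by (simp add: mem_carrier)
    then show ?thesis
      unfolding mem_carrier supp_code by (rule summable_on_subset_banach) blast
  qed
  moreover have "\<exists>N. \<forall>n\<ge>N. d (\<sigma> n) (code A) < r" if "0 < r" for r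
    using close[of "r / 2"] that unfolding d_def by fastforce
  ultimately have "limitin T \<sigma> (code A) sequentially"
    using carr by (auto simp: limit_metric_sequentially)
  then show "\<exists>x. limitin T \<sigma> x sequentially" by blast
qed

theorem polish_group: "polish_group I T"
  using topological_group separable mcomplete Metric_space_axioms
  by (auto simp: polish_group_def polish_group_axioms_def completely_metrizable_space_def)

section \<open>Total disconnectedness and open subgroups\<close>

lemma clopen_coordinate:
  "openin T {x \<in> carrier I. k \<in> supp x}" "closedin T {x \<in> carrier I. k \<in> supp x}"
proof -
  have *: "openin T {x \<in> carrier I. P (k \<in> supp x)}" for P
    unfolding openin_mtopology
  proof (intro conjI allI impI)
    fix x assume x: "x \<in> {x \<in> carrier I. P (k \<in> supp x)}"
    have "mball x (w k) \<subseteq> {x \<in> carrier I. P (k \<in> supp x)}"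
    proof
      fix y assume "y \<in> mball x (w k)"
      then show "y \<in> {x \<in> carrier I. P (k \<in> supp x)}"
        using x mem_supp_eq_of_close[of x y k] by simp
    qed
    then show "\<exists>r>0. mball x r \<subseteq> {x \<in> carrier I. P (k \<in> supp x)}"
      using w_pos by blast
  qed blast
  show "openin T {x \<in> carrier I. k \<in> supp x}"
    using *[of "\<lambda>b. b"] .
  have "carrier I - {x \<in> carrier I. k \<in> supp x} = {x \<in> carrier I. k \<notin> supp x}"
    by blast
  then show "closedin T {x \<in> carrier I. k \<in> supp x}"
    using *[of Not] by (simp add: closedin_def)
qed

theorem totally_disconnected: "totally_disconnected T"
  unfolding totally_disconnected_def
proof
  fix C assume C: "C \<in> connected_components_of T"
  then have con: "connectedin T C" and "C \<noteq> {}"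
    by (simp_all add: connectedin_connected_components_of nonempty_connected_components_of)
  then obtain x where "x \<in> C" by blast
  have "y = x" if "y \<in> C" for y
  proof -
    have "k \<in> supp x \<longleftrightarrow> k \<in> supp y" for k
      using connectedin_clopen_cases[OF con clopen_coordinate(2,1), of k]
        \<open>x \<in> C\<close> \<open>y \<in> C\<close> connectedin_subset_topspace[OF con] by (auto simp: disjnt_iff)
    then show ?thesis by (metis supp_eq_iff subset_antisym subsetI)
  qed
  with \<open>x \<in> C\<close> show "\<exists>x. C = {x}" by blast
qed

text \<open>The subsets of a fixed set are closed under symmetric difference. This is what controls a
  generated group independently of how long the words in the generators are.\<close>

lemma supp_generate_subset:
  assumes "h \<in> generate I X" "X \<subseteq> carrier I"
  shows "supp h \<subseteq> \<Union> (supp ` X)"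
  using assms by induction (auto simp: inv_eq_self subset_iff)

theorem quasi_non_archimedean: "quasi_non_archimedean I T"
  unfolding quasi_non_archimedean_def
proof (intro allI impI)
  fix n V assume "neighborhood T \<one>\<^bsub>I\<^esub> V"
  then obtain W where "openin T W" "\<one>\<^bsub>I\<^esub> \<in> W" "W \<subseteq> V"
    unfolding neighborhood_def by blast
  then obtain r where r: "0 < r" "mball \<one>\<^bsub>I\<^esub> r \<subseteq> V"
    unfolding openin_mtopology by blast
  \<comment> \<open>Dividing by \<open>n + 1\<close> rather than \<open>n\<close> also covers \<open>n = 0\<close> and makes the final bound strict.\<close>
  define s where "s = r / (real n + 1)"
  have s: "0 < s" "s \<le> r" "real n * s < r"
    using r(1) by (simp_all add: s_def field_simps)
  have nbhd: "neighborhood T \<one>\<^bsub>I\<^esub> (mball \<one>\<^bsub>I\<^esub> s)"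
    unfolding neighborhood_def topspace_mtopology
    using s(1) openin_mball mball_subset_mspace centre_in_mball_iff one_closed by blast
  have sub: "mball \<one>\<^bsub>I\<^esub> s \<subseteq> V"
    using r(2) mball_subset_concentric[OF s(2)] by blast
  have "generate I (g ` {..<n}) \<subseteq> V" if g: "\<forall>i<n. g i \<in> mball \<one>\<^bsub>I\<^esub> s" for g
  proof
    fix h assume h: "h \<in> generate I (g ` {..<n})"
    have carr: "g ` {..<n} \<subseteq> carrier I"
      using g by auto
    let ?S = "\<Union>i<n. supp (g i)"
    have S: "w summable_on ?S" "weight ?S \<le> (\<Sum>i<n. weight (supp (g i)))"
      using weight_UN_le[of n "\<lambda>i. supp (g i)"] carr unfolding mem_carrier[symmetric] by blast+
    have "supp h \<subseteq> ?S"
      using supp_generate_subset[OF h carr] by simp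
    then have "weight (supp h) \<le> weight ?S"
      using S(1) weight_mono by blast
    also note S(2)
    also have "(\<Sum>i<n. weight (supp (g i))) \<le> real n * s"
    proof -
      have "weight (supp (g i)) \<le> s" if "i \<in> {..<n}" for i
      proof -
        have "g i \<in> mball \<one>\<^bsub>I\<^esub> s" using g that by blast
        then show ?thesis by (simp add: d_one)
      qed
      then show ?thesis
        using sum_bounded_above[of "{..<n}" "\<lambda>i. weight (supp (g i))" s] by simp
    qed
    also note s(3)
    finally show "h \<in> V"
    proof -
      assume "weight (supp h) < r"
      then have "h \<in> mball \<one>\<^bsub>I\<^esub> r"
        using generate_in_carrier[OF carr h] by (simp add: d_one)
      with r(2) show ?thesis by blast
    qed
  qed
  then show "\<exists>U. neighborhood T \<one>\<^bsub>I\<^esub> U \<and> U \<subseteq> V \<and>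
      (\<forall>g. (\<forall>i<n. g i \<in> U) \<longrightarrow> generate I (g ` {..<n}) \<subseteq> V)"
    using nbhd sub by blast
qed

lemma code_finite_in_subgroup:
  assumes H: "subgroup H I" and "finite F" and "\<And>k. k \<in> F \<Longrightarrow> code {k} \<in> H"
  shows "code F \<in> H"
  using assms(2,3)
proof (induction F rule: finite_induct)
  case empty
  then show ?case using subgroup.one_closed[OF H] by (simp add: I_def)
next
  case (insert k F)
  have "code (insert k F) = code {k} \<otimes>\<^bsub>I\<^esub> code F"
    using insert.hyps by (auto simp flip: supp_eq_iff)
  then show ?case
    using insert subgroup.m_closed[OF H] by simp
qed

text \<open>An open subgroup inside the unit ball would contain every finite subset of some tail, and so
  would bound the finite partial sums of \<open>w\<close> over that tail by \<open>1\<close>.\<close>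

theorem not_non_archimedean:
  assumes lim: "w \<longlonglongrightarrow> 0" and div: "\<not> summable w"
  shows "\<not> non_archimedean I T"
proof
  assume "non_archimedean I T"
  moreover have "openin T (mball \<one>\<^bsub>I\<^esub> 1)" "\<one>\<^bsub>I\<^esub> \<in> mball \<one>\<^bsub>I\<^esub> 1"
    by simp_all
  ultimately obtain U H where H: "subgroup H I" "openin T U" "\<one>\<^bsub>I\<^esub> \<in> U" "U \<subseteq> H"
      "H \<subseteq> mball \<one>\<^bsub>I\<^esub> 1"
    unfolding non_archimedean_def neighbourhood_base_at_def by blast
  from H(2,3,4) obtain r where r: "0 < r" "mball \<one>\<^bsub>I\<^esub> r \<subseteq> H"
    unfolding openin_mtopology by blast
  have "\<forall>\<^sub>F n in sequentially. w n < r"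
    using lim r(1) by (rule order_tendstoD)
  then obtain N where N: "\<And>n. N \<le> n \<Longrightarrow> w n < r"
    by (auto simp: eventually_sequentially)
  have "code {k} \<in> H" if "N \<le> k" for k
  proof -
    have "code {k} \<in> mball \<one>\<^bsub>I\<^esub> r"
      using N[OF that] by (simp add: d_one weight_def mem_carrier)
    with r(2) show ?thesis by blast
  qed
  then have "code F \<in> H" if "finite F" "F \<subseteq> {N..}" for F
    using code_finite_in_subgroup[OF H(1) that(1)] that(2) by blast
  then have "code F \<in> mball \<one>\<^bsub>I\<^esub> 1" if "finite F" "F \<subseteq> {N..}" for F
    using H(5) that by blast
  then have "weight F < 1" if "finite F" "F \<subseteq> {N..}" for F
    using that by (metis d_one in_mball supp_code)
  then have "sum w F \<le> 1" if "finite F" "F \<subseteq> {N..}" for F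
    using that unfolding weight_def by (metis infsum_finite less_imp_le)
  then have "w summable_on {N..}"
    using weight_le_of_finite_subsets[of "{N..}" 1] by blast
  then have "w summable_on ({..<N} \<union> {N..})"
    by (rule summable_on_Un[OF summable_on_finite[OF finite_lessThan]])
  moreover have "{..<N} \<union> {N..} = UNIV" by auto
  ultimately show False
    using div summable_on_UNIV_nonneg_real_iff w_nonneg by metis
qed

end

section \<open>The harmonic summable ideal\<close>

theorem corollary5p12:
  shows "\<exists>(G :: real monoid) (T :: real topology).
    polish_group G T \<and> totally_disconnected T \<and>
    quasi_non_archimedean G T \<and> \<not> non_archimedean G T"
proof -
  define w :: "nat \<Rightarrow> real" where "w n = inverse (real (Suc n))" for n
  obtain supp :: "real \<Rightarrow> nat set" where "bij supp"
    using nat_sets_eqpoll_reals eqpoll_sym unfolding eqpoll_def by blast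
  then interpret summable_ideal w supp
    by unfold_locales (simp_all add: w_def)
  have "w \<longlonglongrightarrow> 0"
    unfolding w_def by (rule LIMSEQ_inverse_real_of_nat)
  moreover have "\<not> summable w"
    using not_summable_harmonic[where 'a = real]
      summable_Suc_iff[of "\<lambda>n. inverse (real n)"] unfolding w_def by blast
  ultimately show ?thesis
    using polish_group totally_disconnected quasi_non_archimedean not_non_archimedean by blast
qed

end
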